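(* There is a universal constant $c>0$ such that for every function $q:\mathbb{N}\to\mathbb{R}_{\ge 0}$, for every (sufficiently large) dimension $d$, and for every randomized online algorithm $A$ for $d$-dimensional online vector bin packing, there exists an instance $I$ such that \[\mathbb{E}[A(I)] \;\geq\; c\cdot \frac{d}{\log^3 d}\cdot \mathrm{OPT}(I) + q(d).\] In other words, every randomized online algorithm for vector bin packing has asymptotic competitive ratio $\Omega(d/\log^3 d)$.
   Context: In $d$-dimensional vector bin packing, an instance is a finite sequence of items $w_1,\dots,w_n$, each a vector in $[0,1]^d$. A set $S$ of items fits feasibly into one bin if $\sum_{i\in S} w_i(j)\le 1$ for every coordinate $j=1,\dots,d$. $\mathrm{OPT}(I)$ denotes the minimum number of bins into which all items of $I$ can be feasibly packed (offline). In the online version, items arrive one at a time, and upon arrival each item must be immediately and irrevocably assigned to some (possibly new) bin so that every bin remains feasible; the algorithm may be randomized. $A(I)$ denotes the number of bins used by $A$ on $I$. An algorithm is called $(\alpha,q(d))$-competitive if $\mathbb{E}[A(I)]\le \alpha\,\mathrm{OPT}(I)+q(d)$ for every instance $I$; the asymptotic competitive ratio refers to the best $\alpha$ achievable with some additive term depending only on $d$. *)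

theory Defs
  imports "HOL-Probability.Probability"
begin

text \<open>An item of dimension d is a vector in [0,1]^d, represented as a function
  nat => real whose coordinates 0..d-1 are relevant. An instance is a finite list of items.\<close>

type_synonym item = "nat \<Rightarrow> real"

definition valid_item :: "nat \<Rightarrow> item \<Rightarrow> bool" where
  "valid_item d w \<longleftrightarrow> (\<forall>j<d. 0 \<le> w j \<and> w j \<le> 1)"

definition valid_instance :: "nat \<Rightarrow> item list \<Rightarrow> bool" where
  "valid_instance d I \<longleftrightarrow> (\<forall>w\<in>set I. valid_item d w)"

definition feasible_packing :: "nat \<Rightarrow> item list \<Rightarrow> nat list \<Rightarrow> bool" where
  "feasible_packing d I p \<longleftrightarrow> length p = length I \<and>
     (\<forall>b. \<forall>j<d. (\<Sum>i | i < length I \<and> p ! i = b. (I ! i) j) \<le> 1)"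

definition OPT :: "nat \<Rightarrow> item list \<Rightarrow> nat" where
  "OPT d I = (LEAST k. \<exists>p. feasible_packing d I p \<and> (\<forall>b\<in>set p. b < k))"

text \<open>A randomized online algorithm: given the items seen so far, its own past
  (irrevocable) decisions, and the newly arrived item, it outputs a probability
  distribution over the bin (index) into which the new item is placed.\<close>

type_synonym online_alg = "item list \<Rightarrow> nat list \<Rightarrow> item \<Rightarrow> nat pmf"

fun run_aux :: "online_alg \<Rightarrow> item list \<Rightarrow> nat list \<Rightarrow> item list \<Rightarrow> nat list pmf" where
  "run_aux A hist decs [] = return_pmf decs"
| "run_aux A hist decs (x # xs) =
     bind_pmf (A hist decs x) (\<lambda>b. run_aux A (hist @ [x]) (decs @ [b]) xs)"

definition run :: "online_alg \<Rightarrow> item list \<Rightarrow> nat list pmf" where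
  "run A I = run_aux A [] [] I"

definition valid_alg :: "nat \<Rightarrow> online_alg \<Rightarrow> bool" where
  "valid_alg d A \<longleftrightarrow> (\<forall>I. valid_instance d I \<longrightarrow>
      (\<forall>p\<in>set_pmf (run A I). feasible_packing d I p))"

definition bins_used :: "nat list \<Rightarrow> nat" where
  "bins_used p = card (set p)"

definition expected_bins :: "online_alg \<Rightarrow> item list \<Rightarrow> real" where
  "expected_bins A I = measure_pmf.expectation (run A I) (\<lambda>p. real (bins_used p))"

end

theory Submission
  imports Defs
begin

text \<open>
  The adversary presents \<open>d\<close> batches of \<open>M\<close> identical items. Batch \<open>i\<close> has a palette
  \<open>P i\<close> of \<open>2s\<close> colours and a colour \<open>f i \<in> P i\<close> which influences only later batches;
  it is in conflict with every earlier batch whose colour is outside \<open>P i\<close>, and with itself.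
  Items of the same colour never conflict, so \<open>M\<close> bins per colour suffice offline.

  The hue of a bin is the set of colours it contains, and an item of batch \<open>i\<close> fits only into
  bins whose hue is contained in \<open>P i\<close>. A hue of more than \<open>s\<close> colours is contained in at most a
  \<open>2 ^ - s\<close> fraction of the palettes, so for a suitable palette almost all of the batch goes, in
  expectation, into bins of hue at most \<open>s\<close>. For each of those at least half of the palette is
  new, so for a suitable colour the sum of the hue sizes grows by a constant fraction of \<open>M\<close>.
  Both choices are made by averaging against the distribution of the algorithm's packing, so the
  instance is deterministic. As a hue has at most \<open>4s\<close> colours, the algorithm needs
  \<open>\<Omega>(d M / s)\<close> bins in expectation against \<open>4 s M\<close> offline, with \<open>s\<close> of order
  \<open>ln d\<close>. Letting \<open>M\<close> grow absorbs the additive term. The argument gives the stronger bound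
  \<open>\<Omega>(d / ln\<^sup>2 d)\<close>.
\<close>

section \<open>Expectations of bounded functions and averaging\<close>

lemma pmf_integrable_bounded:
  fixes g :: "'a \<Rightarrow> real"
  assumes "\<And>x. x \<in> set_pmf P \<Longrightarrow> \<bar>g x\<bar> \<le> B"
  shows "integrable (measure_pmf P) g"
  by (rule measure_pmf.integrable_const_bound[where B = B])
    (use assms in \<open>auto simp: AE_measure_pmf_iff\<close>)

lemma pmf_expectation_mono:
  fixes g h :: "'a \<Rightarrow> real"
  assumes "\<And>x. x \<in> set_pmf P \<Longrightarrow> \<bar>g x\<bar> \<le> B" "\<And>x. x \<in> set_pmf P \<Longrightarrow> \<bar>h x\<bar> \<le> B'"
    and "\<And>x. x \<in> set_pmf P \<Longrightarrow> g x \<le> h x"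
  shows "measure_pmf.expectation P g \<le> measure_pmf.expectation P h"
  by (rule integral_mono_AE)
    (use assms in \<open>auto simp: AE_measure_pmf_iff intro: pmf_integrable_bounded\<close>)

lemma ex_le_average:
  fixes g :: "'a \<Rightarrow> real" and c :: real
  assumes "finite S" "S \<noteq> {}" "sum g S \<le> c * card S"
  shows "\<exists>x\<in>S. g x \<le> c"
proof (rule ccontr)
  assume "\<not> (\<exists>x\<in>S. g x \<le> c)"
  then have "(\<Sum>x\<in>S. c) < sum g S"
    using assms by (intro sum_strict_mono) auto
  with assms show False by (simp add: mult.commute)
qed

text \<open>This makes the adversary deterministic: the average over \<open>S\<close> is controlled
  for every outcome \<open>y\<close> separately, and after exchanging sum and expectation a single
  \<open>x\<close>, chosen before the outcome is known, is good in expectation.\<close>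

lemma ex_expectation_le_average:
  fixes g :: "'a \<Rightarrow> 'b \<Rightarrow> real" and c :: real
  assumes S: "finite S" "S \<noteq> {}"
    and bounded: "\<And>x y. x \<in> S \<Longrightarrow> y \<in> set_pmf P \<Longrightarrow> \<bar>g x y\<bar> \<le> B"
    and avg: "\<And>y. y \<in> set_pmf P \<Longrightarrow> (\<Sum>x\<in>S. g x y) \<le> c * card S"
  shows "\<exists>x\<in>S. measure_pmf.expectation P (g x) \<le> c"
proof (rule ex_le_average[OF S])
  have "(\<Sum>x\<in>S. measure_pmf.expectation P (g x)) =
      measure_pmf.expectation P (\<lambda>y. \<Sum>x\<in>S. g x y)"
    using bounded by (intro Bochner_Integration.integral_sum[symmetric] pmf_integrable_bounded)
  also have "\<dots> \<le> measure_pmf.expectation P (\<lambda>_. c * card S)"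
  proof (rule pmf_expectation_mono)
    fix y assume y: "y \<in> set_pmf P"
    have "\<bar>\<Sum>x\<in>S. g x y\<bar> \<le> (\<Sum>x\<in>S. \<bar>g x y\<bar>)" by (rule sum_abs)
    also have "\<dots> \<le> (\<Sum>x\<in>S. B)" using bounded y by (intro sum_mono)
    finally show "\<bar>\<Sum>x\<in>S. g x y\<bar> \<le> (\<Sum>x\<in>S. B)" .
  qed (use avg in auto)
  finally show "(\<Sum>x\<in>S. measure_pmf.expectation P (g x)) \<le> c * card S" by simp
qed

section \<open>Runs on concatenated instances\<close>

lemma run_aux_append:
  "run_aux A h p (I @ J) = bind_pmf (run_aux A h p I) (\<lambda>q. run_aux A (h @ I) q J)"
  by (induction I arbitrary: h p) (simp_all add: bind_return_pmf bind_assoc_pmf)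

lemma set_run_aux:
  "p' \<in> set_pmf (run_aux A h p I) \<Longrightarrow> \<exists>q. p' = p @ q \<and> length q = length I"
proof (induction I arbitrary: h p)
  case (Cons x I)
  then obtain b where "p' \<in> set_pmf (run_aux A (h @ [x]) (p @ [b]) I)"
    by auto
  from Cons.IH[OF this] show ?case by auto
qed simp

lemma length_run: "p \<in> set_pmf (run A I) \<Longrightarrow> length p = length I"
  unfolding run_def by (auto dest: set_run_aux)

text \<open>Causality: decisions are only ever appended, so the items of \<open>J\<close> cannot
  influence those made on \<open>I\<close>. Hence what is known about the distribution on a prefix
  survives when the adversary extends the instance.\<close>

lemma map_take_run: "map_pmf (take (length I)) (run A (I @ J)) = run A I"
proof -
  have "map_pmf (take (length I)) (run A (I @ J)) =
      bind_pmf (run A I) (\<lambda>p. map_pmf (take (length I)) (run_aux A I p J))"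
    by (simp add: run_def run_aux_append map_bind_pmf)
  also have "\<dots> = bind_pmf (run A I) return_pmf"
  proof (intro bind_pmf_cong refl)
    fix p assume "p \<in> set_pmf (run A I)"
    then have "map_pmf (take (length I)) (run_aux A I p J) = map_pmf (\<lambda>_. p) (run_aux A I p J)"
      by (intro map_pmf_cong refl) (fastforce dest: set_run_aux length_run)
    then show "map_pmf (take (length I)) (run_aux A I p J) = return_pmf p" by simp
  qed
  finally show ?thesis by (simp add: bind_return_pmf')
qed

section \<open>Conflict items, batches and hues\<close>

text \<open>The value \<open>1 / d\<close> is too large to coexist with the full coordinate of a
  conflicting predecessor, yet harmless when up to \<open>d\<close> items share a bin without it.\<close>

definition conflict_item :: "nat \<Rightarrow> (nat \<Rightarrow> 'c) \<Rightarrow> (nat \<Rightarrow> 'c set) \<Rightarrow> nat \<Rightarrow> item" where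
  "conflict_item d f P i j =
    (if j = i then 1 else if j < i \<and> f j \<notin> P i then 1 / real d else 0)"

definition conflict_instance ::
  "nat \<Rightarrow> nat \<Rightarrow> (nat \<Rightarrow> 'c) \<Rightarrow> (nat \<Rightarrow> 'c set) \<Rightarrow> nat \<Rightarrow> item list" where
  "conflict_instance d M f P n = map (\<lambda>l. conflict_item d f P (l div M)) [0..<n * M]"

definition hue :: "nat \<Rightarrow> (nat \<Rightarrow> 'c) \<Rightarrow> nat list \<Rightarrow> nat \<Rightarrow> 'c set" where
  "hue M f p b = (\<lambda>l. f (l div M)) ` {l. l < length p \<and> p ! l = b}"

text \<open>The potential function of the argument.\<close>

definition total_hue :: "nat \<Rightarrow> (nat \<Rightarrow> 'c) \<Rightarrow> nat list \<Rightarrow> nat" where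
  "total_hue M f p = (\<Sum>b\<in>set p. card (hue M f p b))"

lemma length_conflict_instance [simp]: "length (conflict_instance d M f P n) = n * M"
  by (simp add: conflict_instance_def)

lemma conflict_instance_nth:
  "l < n * M \<Longrightarrow> conflict_instance d M f P n ! l = conflict_item d f P (l div M)"
  by (simp add: conflict_instance_def)

lemma conflict_instance_Suc:
  "conflict_instance d M f P (Suc n) =
    conflict_instance d M f P n @ replicate M (conflict_item d f P n)"
proof (rule nth_equalityI)
  fix l assume "l < length (conflict_instance d M f P (Suc n))"
  then have l: "l < Suc n * M" by simp
  show "conflict_instance d M f P (Suc n) ! l =
      (conflict_instance d M f P n @ replicate M (conflict_item d f P n)) ! l"
  proof (cases "l < n * M")
    case True
    then show ?thesis using l by (simp add: nth_append conflict_instance_nth)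
  next
    case False
    then have "l div M = n" using l by (intro div_nat_eqI) (auto simp: mult.commute)
    then show ?thesis using l False by (auto simp: nth_append conflict_instance_nth)
  qed
qed simp

text \<open>Item \<open>i\<close> reads only colours strictly before \<open>i\<close>, so the colour
  of a batch can be fixed after the reaction of the algorithm to that batch.\<close>

lemma conflict_item_cong:
  assumes "\<And>j. j < i \<Longrightarrow> f j = f' j" "P i = P' i"
  shows "conflict_item d f P i = conflict_item d f' P' i"
  using assms by (auto simp: conflict_item_def fun_eq_iff)

lemma conflict_instance_cong:
  assumes "\<And>j. j < n \<Longrightarrow> f j = f' j" "\<And>j. j < n \<Longrightarrow> P j = P' j"
  shows "conflict_instance d M f P n = conflict_instance d M f' P' n"
  unfolding conflict_instance_def
proof (intro map_cong refl conflict_item_cong)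
  fix l assume "l \<in> set [0..<n * M]"
  then have "l div M < n" by (simp add: less_mult_imp_div_less)
  then show "P (l div M) = P' (l div M)" "\<And>j. j < l div M \<Longrightarrow> f j = f' j"
    using assms by auto
qed

lemma valid_conflict_item: "valid_item d (conflict_item d f P i)"
  by (auto simp: valid_item_def conflict_item_def field_simps)

lemma valid_conflict_instance: "valid_instance d (conflict_instance d M f P n)"
  by (auto simp: valid_instance_def conflict_instance_def valid_conflict_item)

lemma hue_cong:
  assumes "\<And>j. j < n \<Longrightarrow> f j = f' j" "length p \<le> n * M"
  shows "hue M f p b = hue M f' p b"
  unfolding hue_def
proof (intro image_cong refl)
  fix l assume "l \<in> {l. l < length p \<and> p ! l = b}"
  then have "l div M < n" using assms(2) by (auto intro: less_mult_imp_div_less)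
  then show "f (l div M) = f' (l div M)" by (rule assms)
qed

lemma hue_append_batch:
  assumes "length p = n * M" "length q = M"
  shows "hue M f (p @ q) b = hue M f p b \<union> (if b \<in> set q then {f n} else {})"
proof -
  have "{l. l < length (p @ q) \<and> (p @ q) ! l = b} =
      {l. l < length p \<and> p ! l = b} \<union> (\<lambda>r. n * M + r) ` {r. r < M \<and> q ! r = b}" (is "?L = ?R")
  proof (intro set_eqI iffI)
    fix l assume l: "l \<in> ?L"
    show "l \<in> ?R"
    proof (cases "l < n * M")
      case False
      then have "l = n * M + (l - n * M)" "l - n * M < M" "q ! (l - n * M) = b"
        using l assms by (auto simp: nth_append)
      then show ?thesis by blast
    qed (use l assms in \<open>auto simp: nth_append\<close>)
  qed (use assms in \<open>auto simp: nth_append\<close>)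
  moreover have "(\<lambda>l. f (l div M)) ` (\<lambda>r. n * M + r) ` {r. r < M \<and> q ! r = b} =
      (if b \<in> set q then {f n} else {})"
  proof -
    have "f ((n * M + r) div M) = f n" if "r < M" for r
      using that by simp
    then have "(\<lambda>l. f (l div M)) ` (\<lambda>r. n * M + r) ` {r. r < M \<and> q ! r = b} =
        (\<lambda>_. f n) ` {r. r < M \<and> q ! r = b}"
      unfolding image_image by (intro image_cong refl) blast
    then show ?thesis using assms by (auto simp: in_set_conv_nth)
  qed
  ultimately show ?thesis by (simp add: hue_def image_Un)
qed

lemma finite_hue [simp]: "finite (hue M f p b)"
  by (simp add: hue_def)

lemma hue_empty: "b \<notin> set p \<Longrightarrow> hue M f p b = {}"
  by (auto simp: hue_def)

lemma hue_subset:
  assumes "\<And>j. j < n \<Longrightarrow> f j \<in> C" "length p \<le> n * M"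
  shows "hue M f p b \<subseteq> C"
  using assms by (auto simp: hue_def intro!: assms(1) less_mult_imp_div_less)

lemma total_hue_cong:
  assumes "\<And>j. j < n \<Longrightarrow> f j = f' j" "length p \<le> n * M"
  shows "total_hue M f p = total_hue M f' p"
  unfolding total_hue_def using hue_cong[OF assms] by simp

text \<open>All items of a batch carry the same colour, so a hue grows by at most one element,
  however many of these items its bin receives.\<close>

lemma total_hue_append_batch:
  assumes "length p = n * M" "length q = M"
  shows "total_hue M f (p @ q) = total_hue M f p + card {b \<in> set q. f n \<notin> hue M f p b}"
proof -
  have "total_hue M f (p @ q) = (\<Sum>b\<in>set p \<union> set q.
      card (hue M f p b) + (if b \<in> set q \<and> f n \<notin> hue M f p b then 1 else 0))"
    unfolding total_hue_def hue_append_batch[OF assms] set_append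
    by (intro sum.cong refl) (auto simp: insert_absorb)
  also have "\<dots> = (\<Sum>b\<in>set p \<union> set q. card (hue M f p b)) +
      card {b \<in> set p \<union> set q. b \<in> set q \<and> f n \<notin> hue M f p b}"
    by (simp add: sum.distrib sum.If_cases Int_def)
  also have "(\<Sum>b\<in>set p \<union> set q. card (hue M f p b)) = total_hue M f p"
    unfolding total_hue_def by (intro sum.mono_neutral_right) (auto simp: hue_empty)
  also have "{b \<in> set p \<union> set q. b \<in> set q \<and> f n \<notin> hue M f p b} =
      {b \<in> set q. f n \<notin> hue M f p b}" by auto
  finally show ?thesis .
qed

lemma total_hue_le:
  assumes "\<And>j. j < n \<Longrightarrow> f j \<in> C" "length p \<le> n * M" "finite C"
  shows "total_hue M f p \<le> card C * bins_used p"
proof -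
  have "total_hue M f p \<le> (\<Sum>b\<in>set p. card C)"
    unfolding total_hue_def
    using hue_subset[of n f C p M] assms by (intro sum_mono card_mono) auto
  then show ?thesis by (simp add: bins_used_def mult.commute)
qed

section \<open>What feasibility forces online and permits offline\<close>

lemma feasible_packing_pair:
  assumes "feasible_packing d I p" "valid_instance d I"
    and "l < length I" "l' < length I" "l \<noteq> l'" "p ! l = p ! l'" "j < d"
  shows "(I ! l) j + (I ! l') j \<le> 1"
proof -
  have "(I ! l) j + (I ! l') j = (\<Sum>i\<in>{l, l'}. (I ! i) j)" using assms by simp
  also have "\<dots> \<le> (\<Sum>i | i < length I \<and> p ! i = p ! l. (I ! i) j)"
    using assms by (intro sum_mono2) (auto simp: valid_instance_def valid_item_def)
  also have "\<dots> \<le> 1" using assms by (auto simp: feasible_packing_def)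
  finally show ?thesis .
qed

text \<open>Two items of batch \<open>n\<close> would both put 1 into coordinate \<open>n\<close>.
  If a bin holds an item of an earlier batch \<open>j\<close> with \<open>f j\<close> outside
  \<open>P n\<close>, coordinate \<open>j\<close> is already full there, and an item of batch
  \<open>n\<close> would add \<open>1 / d > 0\<close> to it.\<close>

lemma batch_packing:
  assumes feas: "feasible_packing d (conflict_instance d M f P (Suc n)) (p @ q)"
    and len: "length p = n * M" "length q = M" and "n < d"
  shows "distinct q" "b \<in> set q \<Longrightarrow> hue M f p b \<subseteq> P n"
proof -
  let ?I = "conflict_instance d M f P (Suc n)"
  note pair = feasible_packing_pair[OF feas valid_conflict_instance]
  have nth: "?I ! (n * M + r) = conflict_item d f P n" if "r < M" for r
    using that by (simp add: conflict_instance_nth)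
  show "distinct q"
    unfolding distinct_conv_nth
  proof (intro allI impI notI)
    fix r r' assume r: "r < length q" "r' < length q" "r \<noteq> r'" "q ! r = q ! r'"
    then have "(?I ! (n * M + r)) n + (?I ! (n * M + r')) n \<le> 1"
      using len \<open>n < d\<close> by (intro pair) (auto simp: nth_append)
    then show False using r len by (simp add: nth conflict_item_def)
  qed
  show "hue M f p b \<subseteq> P n" if "b \<in> set q"
  proof
    fix c assume "c \<in> hue M f p b"
    then obtain l where l: "l < n * M" "p ! l = b" "c = f (l div M)"
      using len by (auto simp: hue_def)
    obtain r where r: "r < M" "q ! r = b"
      using \<open>b \<in> set q\<close> len by (auto simp: in_set_conv_nth)
    have lM: "l div M < n" using l by (simp add: less_mult_imp_div_less)
    have "(?I ! l) (l div M) + (?I ! (n * M + r)) (l div M) \<le> 1"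
      using len \<open>n < d\<close> l r lM by (intro pair) (auto simp: nth_append)
    then show "c \<in> P n"
      using l r lM \<open>n < d\<close> by (auto simp: nth conflict_instance_nth conflict_item_def split: if_splits)
  qed
qed

lemma OPT_conflict_instance_le:
  assumes C: "finite C" "\<And>i. i < d \<Longrightarrow> f i \<in> C" and fP: "\<And>i. i < d \<Longrightarrow> f i \<in> P i"
  shows "OPT d (conflict_instance d M f P d) \<le> card C * M"
proof -
  let ?I = "conflict_instance d M f P d"
  obtain e where e: "bij_betw e C {0..<card C}" using C(1) ex_bij_betw_finite_nat by blast
  \<comment> \<open>A bin stands for a pair of a colour and a position within a batch, encoded in
    base \<open>M\<close>.\<close>
  define p where "p = map (\<lambda>l. e (f (l div M)) * M + l mod M) [0..<d * M]"
  have div: "l div M < d" "l mod M < M" if "l < d * M" for l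
    using that by (auto simp: less_mult_imp_div_less intro!: mod_less_divisor gr0I)
  have eb: "e (f (l div M)) < card C" if "l < d * M" for l
    using bij_betwE[OF e] C(2)[OF div(1)[OF that]] by auto
  have "feasible_packing d ?I p"
    unfolding feasible_packing_def
  proof (intro conjI allI impI)
    show "length p = length ?I" by (simp add: p_def)
    fix b j assume "j < d"
    define L where "L = {l. l < length ?I \<and> p ! l = b}"
    have L: "l < d * M" "e (f (l div M)) = b div M" "l mod M = b mod M" if "l \<in> L" for l
    proof -
      show 1: "l < d * M" using that by (simp add: L_def)
      then have b: "b = e (f (l div M)) * M + l mod M" using that by (simp add: L_def p_def)
      show "e (f (l div M)) = b div M" "l mod M = b mod M"
        using div(2)[OF 1] by (auto simp: b)
    qed
    \<comment> \<open>Items of one bin share their position within the batch, so they come from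
      different batches.\<close>
    have inj: "inj_on (\<lambda>l. l div M) L"
      by (rule inj_onI) (metis L(3) div_mult_mod_eq)
    have same: "f (l div M) = f (l' div M)" if "l \<in> L" "l' \<in> L" for l l'
      using L[OF that(1)] L[OF that(2)] bij_betw_imp_inj_on[OF e] C(2) div(1)
      by (metis inj_onD)
    have "finite L" by (simp add: L_def)
    have "(\<Sum>i\<in>L. (?I ! i) j) = (\<Sum>l\<in>L. conflict_item d f P (l div M) j)"
      by (intro sum.cong refl) (simp add: conflict_instance_nth L(1))
    also have "\<dots> = (\<Sum>i\<in>(\<lambda>l. l div M) ` L. conflict_item d f P i j)"
      by (simp add: sum.reindex[OF inj])
    also have "\<dots> \<le> 1"
    \<comment> \<open>If batch \<open>j\<close> is present, all batches in the bin have its colour,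
      none conflicts with it, and the load is exactly 1. Otherwise at most \<open>d\<close> batches
      contribute at most \<open>1 / d\<close> each.\<close>
    proof (cases "j \<in> (\<lambda>l. l div M) ` L")
      case True
      have "conflict_item d f P i j = (if i = j then 1 else 0)" if i: "i \<in> (\<lambda>l. l div M) ` L" for i
      proof -
        obtain l l' where l: "l \<in> L" "l' \<in> L" "i = l div M" "j = l' div M"
          using i True by blast
        have "f j \<in> P i"
          using same[OF l(1,2)] fP[OF div(1)[OF L(1)[OF l(1)]]] l(3,4) by simp
        then show ?thesis by (simp add: conflict_item_def)
      qed
      then have "(\<Sum>i\<in>(\<lambda>l. l div M) ` L. conflict_item d f P i j) =
          (\<Sum>i\<in>(\<lambda>l. l div M) ` L. if i = j then 1 else 0)"
        by (intro sum.cong refl)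
      then show ?thesis using \<open>finite L\<close> by simp
    next
      case False
      have "(\<lambda>l. l div M) ` L \<subseteq> {..<d}" using div(1) L(1) by auto
      then have card: "card ((\<lambda>l. l div M) ` L) \<le> d"
        using card_mono[of "{..<d}"] by fastforce
      have "(\<Sum>i\<in>(\<lambda>l. l div M) ` L. conflict_item d f P i j) \<le>
          (\<Sum>i\<in>(\<lambda>l. l div M) ` L. 1 / real d)"
        using False by (intro sum_mono) (auto simp: conflict_item_def)
      also have "\<dots> \<le> 1" using card \<open>j < d\<close> by (simp add: field_simps)
      finally show ?thesis .
    qed
    finally show "(\<Sum>i | i < length ?I \<and> p ! i = b. (?I ! i) j) \<le> 1" by (simp add: L_def)
  qed
  moreover have "b < card C * M" if "b \<in> set p" for b
  proof -
    from that obtain l where l: "l < d * M" "b = e (f (l div M)) * M + l mod M"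
      by (auto simp: p_def)
    have "b < (e (f (l div M)) + 1) * M" using l div(2) by simp
    also have "\<dots> \<le> card C * M" using eb[OF l(1)] by (intro mult_right_mono) auto
    finally show ?thesis .
  qed
  ultimately show ?thesis
    unfolding OPT_def by (intro Least_le) blast
qed

section \<open>The adversary for a spread family of palettes\<close>

text \<open>What the adversary needs of its palettes: with \<open>2 * s\<close> colours, a hue of
  size at most \<open>s\<close> leaves half of the palette fresh, while by \<open>spread\<close> a
  uniformly random palette admits a given larger hue with probability at most
  \<open>1 / 2 ^ s\<close>.\<close>

locale spread_family =
  fixes F :: "'c set set" and C :: "'c set" and s :: nat
  assumes finite_C: "finite C" and s_pos: "0 < s" and F_nonempty: "F \<noteq> {}"
    and F_subset: "\<And>X. X \<in> F \<Longrightarrow> X \<subseteq> C"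
    and F_card: "\<And>X. X \<in> F \<Longrightarrow> card X = 2 * s"
    and spread: "\<And>H. finite H \<Longrightarrow> s < card H \<Longrightarrow> 2 ^ s * card {X \<in> F. H \<subseteq> X} \<le> card F"
begin

lemma finite_F: "finite F"
  using F_subset finite_C by (meson Pow_iff finite_Pow_iff finite_subset subsetI)

text \<open>For a palette \<open>X\<close> these are the open bins that can still accept its batch
  although more than half of its colours are already present; they are the loss in the count of
  fresh colours.\<close>

definition crowded_bins :: "nat \<Rightarrow> (nat \<Rightarrow> 'c) \<Rightarrow> nat list \<Rightarrow> 'c set \<Rightarrow> nat set" where
  "crowded_bins M f p X = {b \<in> set p. s < card (hue M f p b) \<and> hue M f p b \<subseteq> X}"

lemma card_crowded_bins_le: "card (crowded_bins M f p X) \<le> length p"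
proof -
  have "card (crowded_bins M f p X) \<le> card (set p)"
    by (intro card_mono) (auto simp: crowded_bins_def)
  also have "\<dots> \<le> length p" by (rule card_length)
  finally show ?thesis .
qed

text \<open>Double counting of pairs of a palette and a bin: \<open>spread\<close> bounds the
  contribution of each bin, and at most \<open>length p\<close> bins are open.\<close>

lemma sum_card_crowded_bins_le:
  "2 ^ s * (\<Sum>X\<in>F. card (crowded_bins M f p X)) \<le> length p * card F"
proof -
  have "(\<Sum>X\<in>F. card (crowded_bins M f p X)) = (\<Sum>X\<in>F. \<Sum>b\<in>set p.
      if s < card (hue M f p b) \<and> hue M f p b \<subseteq> X then 1 else 0)"
    by (intro sum.cong refl) (simp add: crowded_bins_def sum.If_cases Int_def)
  also have "\<dots> = (\<Sum>b\<in>set p. \<Sum>X\<in>F.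
      if s < card (hue M f p b) \<and> hue M f p b \<subseteq> X then 1 else 0)"
    by (rule sum.swap)
  also have "2 ^ s * \<dots> \<le> (\<Sum>b\<in>set p. card F)"
    unfolding sum_distrib_left[of _ _ "set p"]
  proof (intro sum_mono)
    fix b
    have "(\<Sum>X\<in>F. if s < card (hue M f p b) \<and> hue M f p b \<subseteq> X then 1 else 0) =
        (if s < card (hue M f p b) then card {X \<in> F. hue M f p b \<subseteq> X} else 0)"
      using finite_F by (auto simp: sum.If_cases Int_def)
    then show "2 ^ s * (\<Sum>X\<in>F. if s < card (hue M f p b) \<and> hue M f p b \<subseteq> X then 1 else 0)
        \<le> card F"
      using spread[of "hue M f p b"] by simp
  qed
  also have "\<dots> \<le> length p * card F" by (simp add: card_length)
  finally show ?thesis .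
qed

text \<open>Count pairs of a bin of the batch and a palette colour missing from it. A hue of size at
  most \<open>s\<close> inside \<open>X\<close> leaves at least \<open>s\<close> missing colours;
  any other bin is crowded and is compensated by the last summand.\<close>

lemma sum_fresh_ge:
  assumes X: "X \<in> F" and q: "distinct q" "\<And>b. b \<in> set q \<Longrightarrow> hue M f p b \<subseteq> X"
  shows "s * length q \<le> (\<Sum>c\<in>X. card {b \<in> set q. c \<notin> hue M f p b}) +
    s * card (crowded_bins M f p X)"
proof -
  have finX: "finite X" using F_subset[OF X] finite_C finite_subset by blast
  have "s * length q = (\<Sum>b\<in>set q. s)" using q by (simp add: distinct_card)
  also have "\<dots> \<le> (\<Sum>b\<in>set q. card (X - hue M f p b) +
      (if s < card (hue M f p b) then s else 0))"
  proof (intro sum_mono)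
    fix b assume "b \<in> set q"
    then have "card (X - hue M f p b) = 2 * s - card (hue M f p b)"
      using q(2) F_card[OF X] by (simp add: card_Diff_subset)
    then show "s \<le> card (X - hue M f p b) + (if s < card (hue M f p b) then s else 0)" by auto
  qed
  also have "\<dots> = (\<Sum>b\<in>set q. card (X - hue M f p b)) +
      s * card {b \<in> set q. s < card (hue M f p b)}"
    by (simp add: sum.distrib sum.If_cases Int_def)
  also have "(\<Sum>b\<in>set q. card (X - hue M f p b)) =
      (\<Sum>b\<in>set q. \<Sum>c\<in>X. if c \<notin> hue M f p b then 1 else 0)"
    using finX by (intro sum.cong refl) (simp add: sum.If_cases set_diff_eq Int_def)
  also have "\<dots> = (\<Sum>c\<in>X. \<Sum>b\<in>set q. if c \<notin> hue M f p b then 1 else 0)"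
    by (rule sum.swap)
  also have "\<dots> = (\<Sum>c\<in>X. card {b \<in> set q. c \<notin> hue M f p b})"
    by (intro sum.cong refl) (simp add: sum.If_cases Int_def)
  also have "card {b \<in> set q. s < card (hue M f p b)} \<le> card (crowded_bins M f p X)"
  proof (intro card_mono subsetI)
    fix b assume b: "b \<in> {b \<in> set q. s < card (hue M f p b)}"
    then have "hue M f p b \<noteq> {}" by auto
    \<comment> \<open>A bin first opened by the current batch has an empty hue, so it cannot be
      crowded.\<close>
    then have "b \<in> set p" using hue_empty by metis
    then show "b \<in> crowded_bins M f p X" using b q(2) by (simp add: crowded_bins_def)
  qed (simp add: crowded_bins_def)
  finally show ?thesis by simp
qed

text \<open>The palette \<open>X\<close> is chosen against the run before batch \<open>n\<close>,
  the colour \<open>c\<close> against the run including it. The gain \<open>M / 4\<close> is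
  \<open>M / 2\<close> from averaging over the palette, less at most \<open>M / 4\<close> for
  crowded bins.\<close>

lemma extend_one_batch:
  fixes f :: "nat \<Rightarrow> 'c" and P :: "nat \<Rightarrow> 'c set"
  assumes A: "valid_alg d A" and "n < d" and s: "2 * d \<le> 2 ^ s"
  obtains X c where "X \<in> F" "c \<in> X"
    "measure_pmf.expectation (run A (conflict_instance d M f P n)) (\<lambda>p. real (total_hue M f p))
        + real M / 4
      \<le> measure_pmf.expectation (run A (conflict_instance d M (f(n := c)) (P(n := X)) (Suc n)))
          (\<lambda>p. real (total_hue M (f(n := c)) p))"
proof -
  define R where "R = run A (conflict_instance d M f P n)"
  have len_R: "length p = n * M" if "p \<in> set_pmf R" for p
    using length_run that by (fastforce simp: R_def)
  have "\<exists>X\<in>F. measure_pmf.expectation R (\<lambda>p. real (card (crowded_bins M f p X))) \<le> n * M / 2 ^ s"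
  proof (rule ex_expectation_le_average[OF finite_F F_nonempty])
    fix p assume p: "p \<in> set_pmf R"
    show "\<bar>real (card (crowded_bins M f p X))\<bar> \<le> n * M" for X
      using card_crowded_bins_le[of M f p X] len_R[OF p] by (simp flip: of_nat_mult)
    have "real (2 ^ s * (\<Sum>X\<in>F. card (crowded_bins M f p X))) \<le> real (n * M * card F)"
      using sum_card_crowded_bins_le[of M f p] len_R[OF p] by (simp only: of_nat_le_iff)
    then show "(\<Sum>X\<in>F. real (card (crowded_bins M f p X))) \<le> n * M / 2 ^ s * card F"
      by (simp add: field_simps)
  qed
  then obtain X where X: "X \<in> F"
    and crowded_avg: "measure_pmf.expectation R (\<lambda>p. real (card (crowded_bins M f p X))) \<le> n * M / 2 ^ s"
    by blast
  define I where "I = conflict_instance d M f (P(n := X)) n @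
    replicate M (conflict_item d f (P(n := X)) n)"
  define Q where "Q = run A I"
  define t where "t = (\<lambda>p :: nat list. take (n * M) p)"
  define u where "u = (\<lambda>p :: nat list. drop (n * M) p)"
  \<comment> \<open>The colour of batch \<open>n\<close> does not occur in the instance so far, so
    \<open>Q\<close> is fixed before \<open>c\<close> is chosen.\<close>
  have I_eq: "conflict_instance d M (f(n := c)) (P(n := X)) (Suc n) = I" for c
    unfolding I_def conflict_instance_Suc
    by (intro arg_cong2[where f = append] arg_cong[where f = "replicate M"]
        conflict_instance_cong conflict_item_cong) auto
  have I_eq': "I = conflict_instance d M f P n @ replicate M (conflict_item d f (P(n := X)) n)"
    unfolding I_def by (intro arg_cong2[where f = append] conflict_instance_cong) auto
  have R_eq: "R = map_pmf t Q"
    unfolding Q_def R_def t_def I_eq'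
    using map_take_run[of "conflict_instance d M f P n" A] by simp
  have len: "length (t p) = n * M" "length (u p) = M" "t p @ u p = p" if "p \<in> set_pmf Q" for p
    using length_run[of p A I] that by (simp_all add: Q_def t_def u_def I_def)
  have pack: "distinct (u p)" "\<And>b. b \<in> set (u p) \<Longrightarrow> hue M f (t p) b \<subseteq> X"
    if p: "p \<in> set_pmf Q" for p
  proof -
    have "valid_instance d I"
      using valid_conflict_instance I_eq by metis
    then have "feasible_packing d I p"
      using A p by (auto simp: valid_alg_def Q_def)
    then have *: "feasible_packing d (conflict_instance d M f (P(n := X)) (Suc n)) (t p @ u p)"
      using len(3)[OF p] I_eq[of "f n"] by simp
    show "distinct (u p)" "\<And>b. b \<in> set (u p) \<Longrightarrow> hue M f (t p) b \<subseteq> X"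
      using batch_packing[OF * len(1,2)[OF p] \<open>n < d\<close>] by auto
  qed
  define fresh where "fresh = (\<lambda>c p. real (card {b \<in> set (u p). c \<notin> hue M f (t p) b}))"
  define crowded where "crowded = (\<lambda>p. real (card (crowded_bins M f (t p) X)))"
  have fresh_le: "\<bar>fresh c p\<bar> \<le> M" if "p \<in> set_pmf Q" for c p
  proof -
    have "card {b \<in> set (u p). c \<notin> hue M f (t p) b} \<le> card (set (u p))"
      by (intro card_mono) auto
    also have "\<dots> \<le> M" using card_length[of "u p"] len(2)[OF that] by simp
    finally show ?thesis by (simp add: fresh_def)
  qed
  have crowded_le: "\<bar>crowded p\<bar> \<le> n * M" if "p \<in> set_pmf Q" for p
    using card_crowded_bins_le[of M f "t p" X] len(1)[OF that] by (simp add: crowded_def flip: of_nat_mult)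
  have finX: "finite X" "X \<noteq> {}"
    using F_subset[OF X] finite_C finite_subset F_card[OF X] s_pos by (blast, auto)
  \<comment> \<open>The lower bound \<open>s * M - s * crowded\<close> on the sum over the
    \<open>2 * s\<close> colours gives \<open>M / 2 - crowded / 2\<close> on average; the signs are
    reversed to fit the averaging lemma, which bounds from above.\<close>
  have "\<exists>c\<in>X. measure_pmf.expectation Q (\<lambda>p. - (fresh c p + crowded p / 2)) \<le> - (real M / 2)"
  proof (rule ex_expectation_le_average[OF finX])
    fix p assume p: "p \<in> set_pmf Q"
    show "\<bar>- (fresh c p + crowded p / 2)\<bar> \<le> real M + n * M" for c
      using fresh_le[OF p, of c] crowded_le[OF p] by linarith
    have "real (s * M) \<le> real ((\<Sum>c\<in>X. card {b \<in> set (u p). c \<notin> hue M f (t p) b}) +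
        s * card (crowded_bins M f (t p) X))"
      using sum_fresh_ge[OF X pack[OF p]] len(2)[OF p] by (simp only: of_nat_le_iff)
    then show "(\<Sum>c\<in>X. - (fresh c p + crowded p / 2)) \<le> - (real M / 2) * card X"
      using F_card[OF X] by (simp add: sum_negf sum_subtractf sum.distrib fresh_def crowded_def mult.commute)
  qed
  then obtain c where c: "c \<in> X"
    and "measure_pmf.expectation Q (\<lambda>p. - (fresh c p + crowded p / 2)) \<le> - (real M / 2)" by blast
  moreover have int: "integrable Q (fresh c)" "integrable Q crowded"
    using fresh_le crowded_le by (auto intro: pmf_integrable_bounded)
  ultimately have "measure_pmf.expectation Q (fresh c) + measure_pmf.expectation Q crowded / 2 \<ge> M / 2"
    by simp
  moreover have "measure_pmf.expectation Q crowded \<le> M / 2"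
  proof -
    have "measure_pmf.expectation Q crowded \<le> n * M / 2 ^ s"
      using crowded_avg by (simp add: R_eq crowded_def)
    also have "\<dots> \<le> M / 2"
    proof -
      have "2 * real n \<le> 2 ^ s"
        using s \<open>n < d\<close> of_nat_mono[of "2 * n" "2 ^ s", where 'a = real] by simp
      then have "2 * real n * real M \<le> 2 ^ s * real M" by (intro mult_right_mono) auto
      then show ?thesis by (simp add: field_simps)
    qed
    finally show ?thesis .
  qed
  ultimately have fresh_ge: "measure_pmf.expectation Q (fresh c) \<ge> M / 4" by simp
  have hue_Suc: "real (total_hue M (f(n := c)) p) = real (total_hue M f (t p)) + fresh c p"
    if p: "p \<in> set_pmf Q" for p
  proof -
    have "total_hue M (f(n := c)) (t p @ u p) = total_hue M (f(n := c)) (t p) +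
        card {b \<in> set (u p). c \<notin> hue M (f(n := c)) (t p) b}"
      using total_hue_append_batch[OF len(1,2)[OF p], of "f(n := c)"] by simp
    also have "total_hue M (f(n := c)) (t p) = total_hue M f (t p)"
      using len(1)[OF p] by (intro total_hue_cong[of n]) auto
    also have "hue M (f(n := c)) (t p) = hue M f (t p)"
      using len(1)[OF p] by (intro ext hue_cong[of n]) auto
    finally show ?thesis unfolding len(3)[OF p] by (simp only: fresh_def of_nat_add)
  qed
  \<comment> \<open>A crude bound, for integrability. Since \<open>f\<close> is arbitrary here, the
    image of \<open>{..<n}\<close> serves as the colour set.\<close>
  have hue_le: "\<bar>real (total_hue M f (t p))\<bar> \<le> card (f ` {..<n}) * (n * M)" if p: "p \<in> set_pmf Q" for p
  proof -
    have "total_hue M f (t p) \<le> card (f ` {..<n}) * bins_used (t p)"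
      using len(1)[OF p] by (intro total_hue_le[of n]) auto
    also have "bins_used (t p) \<le> n * M"
      using card_length[of "t p"] len(1)[OF p] by (simp add: bins_used_def)
    finally show ?thesis by (simp flip: of_nat_mult)
  qed
  have "measure_pmf.expectation Q (\<lambda>p. real (total_hue M (f(n := c)) p)) =
      measure_pmf.expectation Q (\<lambda>p. real (total_hue M f (t p)) + fresh c p)"
    using hue_Suc by (intro integral_cong_AE) (auto simp: AE_measure_pmf_iff)
  also have "\<dots> = measure_pmf.expectation Q (\<lambda>p. real (total_hue M f (t p))) +
      measure_pmf.expectation Q (fresh c)"
    by (intro Bochner_Integration.integral_add pmf_integrable_bounded[OF hue_le] int)
  also have "measure_pmf.expectation Q (\<lambda>p. real (total_hue M f (t p))) =
      measure_pmf.expectation R (\<lambda>p. real (total_hue M f p))"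
    by (simp add: R_eq)
  finally show thesis
    using that[OF X c] fresh_ge unfolding I_eq R_def Q_def by linarith
qed

lemma ex_conflict_instance_total_hue:
  assumes "valid_alg d A" "n \<le> d" "2 * d \<le> 2 ^ s"
  shows "\<exists>f P. (\<forall>j<n. P j \<in> F \<and> f j \<in> P j) \<and>
    real n * M / 4 \<le> measure_pmf.expectation (run A (conflict_instance d M f P n))
      (\<lambda>p. real (total_hue M f p))"
  using assms(2)
proof (induction n)
  case 0
  show ?case by simp
next
  case (Suc n)
  then obtain f :: "nat \<Rightarrow> 'c" and P where fP: "\<forall>j<n. P j \<in> F \<and> f j \<in> P j"
    and "real n * M / 4 \<le> measure_pmf.expectation (run A (conflict_instance d M f P n))
      (\<lambda>p. real (total_hue M f p))" by auto
  moreover obtain X c where Xc: "X \<in> F" "c \<in> X"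
    "measure_pmf.expectation (run A (conflict_instance d M f P n)) (\<lambda>p. real (total_hue M f p))
        + real M / 4
      \<le> measure_pmf.expectation (run A (conflict_instance d M (f(n := c)) (P(n := X)) (Suc n)))
          (\<lambda>p. real (total_hue M (f(n := c)) p))"
    using extend_one_batch[of d A n] assms Suc.prems by (metis Suc_le_eq)
  moreover have "\<forall>j<Suc n. (P(n := X)) j \<in> F \<and> (f(n := c)) j \<in> (P(n := X)) j"
    using fP Xc by (auto simp: less_Suc_eq)
  moreover have "real (Suc n) * M / 4 = real n * M / 4 + real M / 4" by (simp add: field_simps)
  ultimately show ?case
    by (intro exI[of _ "f(n := c)"] exI[of _ "P(n := X)"] conjI) (assumption | linarith)+
qed

text \<open>After \<open>d\<close> batches the expected potential is at least
  \<open>d * M / 4\<close>, and each bin accounts for at most \<open>card C\<close> of it.\<close>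

lemma ex_hard_instance:
  assumes "valid_alg d A" "2 * d \<le> 2 ^ s"
  shows "\<exists>I. valid_instance d I \<and> OPT d I \<le> card C * M \<and>
    real d * M / 4 \<le> card C * expected_bins A I"
proof -
  obtain f :: "nat \<Rightarrow> 'c" and P where fP: "\<forall>j<d. P j \<in> F \<and> f j \<in> P j"
    and ge: "real d * M / 4 \<le> measure_pmf.expectation (run A (conflict_instance d M f P d))
      (\<lambda>p. real (total_hue M f p))"
    using ex_conflict_instance_total_hue[OF assms(1) order_refl assms(2)] by blast
  let ?I = "conflict_instance d M f P d"
  have fC: "f j \<in> C" if "j < d" for j using fP that F_subset by blast
  note ge
  also have "measure_pmf.expectation (run A ?I) (\<lambda>p. real (total_hue M f p)) \<le>
      measure_pmf.expectation (run A ?I) (\<lambda>p. real (card C) * real (bins_used p))"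
  proof (rule pmf_expectation_mono)
    fix p assume "p \<in> set_pmf (run A ?I)"
    then have p: "length p = d * M" using length_run by fastforce
    have "total_hue M f p \<le> card C * bins_used p"
      using p fC finite_C by (intro total_hue_le[of d]) auto
    then show 1: "real (total_hue M f p) \<le> real (card C) * real (bins_used p)"
      by (simp flip: of_nat_mult)
    show 2: "\<bar>real (card C) * real (bins_used p)\<bar> \<le> real (card C) * real (d * M)"
      using card_length[of p] p by (auto simp: bins_used_def intro!: mult_left_mono simp flip: of_nat_mult)
    show "\<bar>real (total_hue M f p)\<bar> \<le> real (card C) * real (d * M)"
      using 1 2 by linarith
  qed
  also have "\<dots> = card C * expected_bins A ?I"
    by (simp add: expected_bins_def)
  finally show ?thesis
    using OPT_conflict_instance_le[of C d f P M] finite_C fC fP valid_conflict_instance by blast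
qed

end

section \<open>A concrete spread family\<close>

text \<open>The graph of the indicator function of \<open>X\<close>: one of the two colours
  \<open>(t, False)\<close> and \<open>(t, True)\<close> is selected for each
  \<open>t < m\<close>.\<close>

definition bit_palette :: "nat \<Rightarrow> nat set \<Rightarrow> (nat \<times> bool) set" where
  "bit_palette m X = (\<lambda>t. (t, t \<in> X)) ` {..<m}"

text \<open>If some palette contains \<open>H\<close>, then \<open>H\<close> prescribes the bits at
  \<open>card H\<close> different positions, and a palette containing \<open>H\<close> is determined
  by its remaining \<open>m - card H\<close> bits. Otherwise the count is 0.\<close>

lemma card_bit_palettes_superset:
  assumes "finite H"
  shows "2 ^ card H * card {X \<in> Pow {..<m}. H \<subseteq> bit_palette m X} \<le> 2 ^ m"
proof (cases "\<exists>X. H \<subseteq> bit_palette m X")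
  case True
  let ?S = "{X \<in> Pow {..<m}. H \<subseteq> bit_palette m X}"
  obtain X where X: "H \<subseteq> bit_palette m X" using True by blast
  have inj: "inj_on fst H"
    by (rule inj_on_subset[OF _ X]) (auto simp: bit_palette_def inj_on_def)
  have sub: "fst ` H \<subseteq> {..<m}"
    using X by (auto simp: bit_palette_def)
  have "inj_on (\<lambda>X. X - fst ` H) ?S"
  proof (rule inj_onI)
    fix X Y assume XY: "X \<in> ?S" "Y \<in> ?S" "X - fst ` H = Y - fst ` H"
    have "t \<in> X \<longleftrightarrow> t \<in> Y" if "t \<in> fst ` H" for t
      using that XY(1,2) by (auto simp: bit_palette_def)
    with XY(3) show "X = Y" by blast
  qed
  then have "card ?S \<le> card (Pow ({..<m} - fst ` H))"
    by (rule card_inj_on_le) auto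
  also have "\<dots> = 2 ^ (m - card H)"
    using sub inj assms by (simp add: card_Pow card_Diff_subset card_image)
  finally have "2 ^ card H * card ?S \<le> 2 ^ card H * 2 ^ (m - card H)" by simp
  also have "\<dots> = 2 ^ m"
    using card_mono[OF _ sub] card_image[OF inj] by (simp flip: power_add)
  finally show ?thesis .
next
  case False
  then have "{X \<in> Pow {..<m}. H \<subseteq> bit_palette m X} = {}" by blast
  then show ?thesis by (simp only: card.empty mult_0_right)
qed

lemma spread_family_bit_palettes:
  assumes "0 < s"
  shows "spread_family (bit_palette (2 * s) ` Pow {..<2 * s}) ({..<2 * s} \<times> UNIV) s"
proof
  let ?F = "bit_palette (2 * s) ` Pow {..<2 * s}"
  fix H :: "(nat \<times> bool) set" assume H: "finite H" "s < card H"
  \<comment> \<open>Injectivity makes the number of palettes the full \<open>2 ^ (2 * s)\<close>,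
    against which the supersets of \<open>H\<close> are compared.\<close>
  have "inj_on (bit_palette (2 * s)) (Pow {..<2 * s})"
  proof (rule inj_onI)
    fix X Y assume XY: "X \<in> Pow {..<2 * s}" "Y \<in> Pow {..<2 * s}"
      "bit_palette (2 * s) X = bit_palette (2 * s) Y"
    have "t \<in> X \<longleftrightarrow> t \<in> Y" if "t < 2 * s" for t
    proof -
      have "(t, t \<in> X) \<in> bit_palette (2 * s) Y"
        using that unfolding XY(3)[symmetric] by (simp add: bit_palette_def)
      then show ?thesis by (auto simp: bit_palette_def)
    qed
    with XY(1,2) show "X = Y" by blast
  qed
  then have card_F: "card ?F = 2 ^ (2 * s)" by (simp add: card_image card_Pow)
  have "{X \<in> ?F. H \<subseteq> X} =
      bit_palette (2 * s) ` {X \<in> Pow {..<2 * s}. H \<subseteq> bit_palette (2 * s) X}" by blast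
  then have "card {X \<in> ?F. H \<subseteq> X} \<le> card {X \<in> Pow {..<2 * s}. H \<subseteq> bit_palette (2 * s) X}"
    by (simp only:) (intro card_image_le, simp)
  then have "2 ^ s * card {X \<in> ?F. H \<subseteq> X} \<le>
      2 ^ card H * card {X \<in> Pow {..<2 * s}. H \<subseteq> bit_palette (2 * s) X}"
    using H by (intro mult_mono power_increasing) auto
  then show "2 ^ s * card {X \<in> ?F. H \<subseteq> X} \<le> card ?F"
    using card_bit_palettes_superset[OF H(1), of "2 * s"] card_F by linarith
next
  fix X assume "X \<in> bit_palette (2 * s) ` Pow {..<2 * s}"
  then show "card X = 2 * s"
    by (auto simp: bit_palette_def card_image inj_on_def)
qed (use assms in \<open>auto simp: bit_palette_def\<close>)

section \<open>Choice of parameters and the final bound\<close>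

lemma online_lower_bound_log_squared:
  assumes "4 \<le> d" "valid_alg d A"
  shows "\<exists>I. valid_instance d I \<and>
    expected_bins A I \<ge> 1 / 1152 * (real d / (ln (real d))\<^sup>2) * real (OPT d I) + q"
proof -
  define L where "L = ln (real d)"
  \<comment> \<open>The least \<open>s\<close> with \<open>2 * d \<le> 2 ^ s\<close>.\<close>
  define s where "s = nat \<lceil>log 2 (2 * real d)\<rceil>"
  have "4 / 3 \<le> 2 * ln (2 :: real)" using ln2_ge_two_thirds by simp
  also have "\<dots> = ln (4 :: real)" using ln_realpow[of 2 2] by simp
  also have "\<dots> \<le> L" using assms by (simp add: L_def)
  finally have L: "4 / 3 \<le> L" .
  have log: "log 2 (2 * real d) = 1 + L / ln 2"
    using assms by (simp add: log_def ln_mult L_def field_simps)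
  \<comment> \<open>The goal is \<open>s \<le> 3 * L\<close>: \<open>s\<close> is below
    \<open>2 + L / ln 2\<close>, and both summands are at most \<open>3 / 2 * L\<close>, the first
    because \<open>4 / 3 \<le> L\<close>.\<close>
  have "L / ln 2 \<le> 3 / 2 * L"
    using L ln2_ge_two_thirds divide_left_mono[of "2 / 3" "ln 2" L] by simp
  moreover have "0 \<le> L / ln 2" using L by simp
  moreover have "real s < log 2 (2 * real d) + 1" "log 2 (2 * real d) \<le> s"
    using log \<open>0 \<le> L / ln 2\<close> unfolding s_def by linarith+
  ultimately have s: "1 \<le> real s" "real s \<le> 3 * L" using L log by linarith+
  have "2 * real d = 2 powr log 2 (2 * real d)" using assms by simp
  also have "\<dots> \<le> 2 powr s" using \<open>log 2 (2 * real d) \<le> s\<close> by simp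
  finally have "real (2 * d) \<le> real (2 ^ s)" by (simp add: powr_realpow)
  then have d_le: "2 * d \<le> 2 ^ s" by (simp only: of_nat_le_iff)
  interpret spread_family "bit_palette (2 * s) ` Pow {..<2 * s}" "{..<2 * s} \<times> UNIV" s
    using s by (intro spread_family_bit_palettes) simp
  \<comment> \<open>Half of the bound \<open>d * M / (48 * L)\<close> on the expected number of bins
    is reserved for \<open>q\<close>, which this \<open>M\<close> makes possible.\<close>
  obtain M :: nat where M: "q * (96 * L) \<le> M"
    using real_arch_simple by blast
  obtain I where I: "valid_instance d I" "OPT d I \<le> 4 * s * M"
    "real d * M / 4 \<le> 4 * s * expected_bins A I"
    using ex_hard_instance[OF assms(2) d_le, of M] by auto
  have E_nonneg: "0 \<le> expected_bins A I" by (simp add: expected_bins_def)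
  have "real d * M / 4 \<le> 4 * (3 * L) * expected_bins A I"
    using I(3) mult_right_mono[OF s(2) E_nonneg] by simp
  then have E: "real d * M / (48 * L) \<le> expected_bins A I" using L by (simp add: field_simps)
  have "real (OPT d I) \<le> real (4 * s * M)" using I(2) by (simp only: of_nat_le_iff)
  also have "\<dots> \<le> 12 * L * M" using s(2) mult_right_mono[of "real s" "3 * L" "real M"] by (simp add: mult_ac)
  finally have "1 / 1152 * (real d / L\<^sup>2) * real (OPT d I) \<le> 1 / 1152 * (real d / L\<^sup>2) * (12 * L * M)"
    by (intro mult_left_mono) auto
  \<comment> \<open>The other half pays for the multiple of \<open>OPT\<close>:
    \<open>1152 = 12 * 96\<close>.\<close>
  also have "\<dots> = real d * M / (96 * L)" using L by (simp add: field_simps power2_eq_square)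
  finally have opt: "1 / 1152 * (real d / L\<^sup>2) * real (OPT d I) \<le> real d * M / (96 * L)" .
  have "q \<le> M / (96 * L)" using M L by (simp add: field_simps)
  also have "\<dots> \<le> real d * M / (96 * L)"
    using assms L mult_right_mono[of 1 "real d" "real M"] by (intro divide_right_mono) auto
  finally have "q \<le> real d * M / (96 * L)" .
  moreover have "real d * M / (96 * L) + real d * M / (96 * L) = real d * M / (48 * L)"
    by (simp add: field_simps)
  ultimately show ?thesis using opt E I(1) unfolding L_def by (intro exI[of _ I]) linarith
qed

theorem theorem1:
  shows "\<exists>c::real. c > 0 \<and>
    (\<forall>q::nat \<Rightarrow> real. (\<forall>n. q n \<ge> 0) \<longrightarrow>
      (\<exists>d0::nat. \<forall>d\<ge>d0. \<forall>A. valid_alg d A \<longrightarrow>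
         (\<exists>I. valid_instance d I \<and>
            expected_bins A I \<ge> c * (real d / (ln (real d)) ^ 3) * real (OPT d I) + q d)))"
proof (intro exI[of _ "1 / 1152 :: real"] conjI allI impI exI[of _ "4 :: nat"])
  fix q :: "nat \<Rightarrow> real" and d A assume d: "4 \<le> d" "valid_alg d A"
  obtain I where I: "valid_instance d I"
    "expected_bins A I \<ge> 1 / 1152 * (real d / (ln (real d))\<^sup>2) * real (OPT d I) + q d"
    using online_lower_bound_log_squared[OF d] by blast
  \<comment> \<open>From \<open>d \<ge> 4 > exp 1\<close> the logarithm is at least 1, so a third
    factor of it only weakens the bound.\<close>
  have "exp 1 \<le> real d" using exp_le d(1) by linarith
  then have "1 \<le> ln (real d)" using d(1) by (simp add: ln_ge_iff)
  then have "real d / ln (real d) ^ 3 \<le> real d / (ln (real d))\<^sup>2"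
    by (intro divide_left_mono power_increasing) auto
  then have "1 / 1152 * (real d / ln (real d) ^ 3) * real (OPT d I) \<le>
      1 / 1152 * (real d / (ln (real d))\<^sup>2) * real (OPT d I)"
    by (intro mult_right_mono) auto
  with I show "\<exists>I. valid_instance d I \<and>
      expected_bins A I \<ge> 1 / 1152 * (real d / (ln (real d)) ^ 3) * real (OPT d I) + q d"
    by (intro exI[of _ I]) linarith
qed simp

end
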